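(* Let $(R,<)$ be a dense and Cauchy complete ordered ring whose order $\leq$ is a total ordering. Assume that $(x_n)$, $(y_n)$, and $(z_n)$ are sequences in $R$ and that there is a natural number $N_1$ such that $n\geq N_1$ implies $x_n\leq y_n\leq z_n$. If $\sum_{n=1}^{+\infty}x_n$ and $\sum_{n=1}^{+\infty}z_n$ are convergent, then so is the series $\sum_{n=1}^{+\infty}y_n$.
   Context: $(R,<)$ with $\leq$ total is an ordered ring if $R$ is a ring, $a<b$ implies $a+c<b+c$, and $a<b$, $0<c$ imply $ac<bc$ and $ca<cb$, for all $a,b,c\in R$ (similarly for $\leq$, with $c\geq 0$). Put $|x|=\max\{x,-x\}$. $R$ is dense if for any $\alpha>0$ in $R$ there are $\beta>0$ and $\gamma>0$ in $R$ with $\beta+\gamma<\alpha$. A sequence $(x_n)$ in $R$ converges to $a\in R$ if for every $\epsilon>0$ in $R$ there is a natural number $N$ such that $n\geq N$ implies $|x_n-a|<\epsilon$; it is Cauchy if for every $\epsilon>0$ in $R$ there is $N$ such that $m,n\geq N$ implies $|x_n-x_m|<\epsilon$. $(R,<)$ is Cauchy complete if each Cauchy sequence in $R$ converges to an element of $R$. A series converges if its sequence of partial sums converges. *)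

theory Defs
  imports Main
begin

text \<open>
  A totally ordered ring is a type of class \<open>linordered_ring_strict\<close>: an associative ring,
  not required to be commutative or to have a unit, with a total order such that addition and
  multiplication by positive elements, on either side, are strictly monotone.
\<close>

(* The class defines the absolute value by cases on the sign. *)
lemma abs_eq_max_uminus:
  fixes x :: "'a :: linordered_ring_strict"
  shows "\<bar>x\<bar> = max x (- x)"
  by (auto simp: max_def abs_if not_less dest: less_imp_le)

definition dense_ring :: "'a :: linordered_ring_strict itself \<Rightarrow> bool" where
  "dense_ring _ \<longleftrightarrow>
     (\<forall>\<alpha>::'a. \<alpha> > 0 \<longrightarrow> (\<exists>\<beta> \<gamma>. \<beta> > 0 \<and> \<gamma> > 0 \<and> \<beta> + \<gamma> < \<alpha>))"

(* In the definitions below, \<epsilon> ranges over the ring itself. *)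
definition ring_converges_to :: "(nat \<Rightarrow> 'a :: linordered_ring_strict) \<Rightarrow> 'a \<Rightarrow> bool" where
  "ring_converges_to x a \<longleftrightarrow> (\<forall>\<epsilon>>0. \<exists>N. \<forall>n\<ge>N. \<bar>x n - a\<bar> < \<epsilon>)"

definition ring_convergent :: "(nat \<Rightarrow> 'a :: linordered_ring_strict) \<Rightarrow> bool" where
  "ring_convergent x \<longleftrightarrow> (\<exists>a. ring_converges_to x a)"

definition ring_Cauchy :: "(nat \<Rightarrow> 'a :: linordered_ring_strict) \<Rightarrow> bool" where
  "ring_Cauchy x \<longleftrightarrow> (\<forall>\<epsilon>>0. \<exists>N. \<forall>m\<ge>N. \<forall>n\<ge>N. \<bar>x n - x m\<bar> < \<epsilon>)"

definition Cauchy_complete_ring :: "'a :: linordered_ring_strict itself \<Rightarrow> bool" where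
  "Cauchy_complete_ring _ \<longleftrightarrow> (\<forall>x :: nat \<Rightarrow> 'a. ring_Cauchy x \<longrightarrow> ring_convergent x)"

(* Series start at index 1; the value x 0 is never used, and the 0-th partial sum is the empty
   sum 0, which does not affect convergence. *)
definition ring_series_convergent :: "(nat \<Rightarrow> 'a :: linordered_ring_strict) \<Rightarrow> bool" where
  "ring_series_convergent x \<longleftrightarrow> ring_convergent (\<lambda>n. \<Sum>k=1..n. x k)"

end

theory Submission
  imports Defs
begin

text \<open>
  The idea is the Cauchy criterion. Completeness reduces the claim to showing that the partial
  sums of \<open>y\<close> form a Cauchy sequence, that is, that the late blocks \<open>y (m+1) + \<dots> + y n\<close> are small.
  Such a block lies between the corresponding blocks of \<open>x\<close> and \<open>z\<close>, and both of these are small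
  because convergent series have Cauchy partial sums
  (\<open>convergent_imp_Cauchy_if_dense\<close>). Density enters in that implication: in a ring
  where \<open>\<alpha> / 2\<close> need not exist, it splits a given \<open>\<alpha> > 0\<close> into two positive tolerances whose sum
  is below \<open>\<alpha>\<close>. A lower bound \<open>- \<epsilon>\<close> from \<open>x\<close> and an upper bound \<open>\<epsilon>\<close> from \<open>z\<close> then bound the absolute
  value of the block of \<open>y\<close> by the same \<open>\<epsilon>\<close>, with no further splitting.
\<close>

text \<open>
  The triangle inequality through the limit; the two distances to the limit are controlled by the
  two tolerances that density provides in place of \<open>\<alpha> / 2\<close>.
\<close>

lemma convergent_imp_Cauchy_if_dense:
  fixes s :: "nat \<Rightarrow> 'a :: linordered_ring_strict"
  assumes "dense_ring TYPE('a)" and "ring_convergent s"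
  shows "ring_Cauchy s"
  unfolding ring_Cauchy_def
proof (intro allI impI)
  fix \<alpha> :: 'a
  assume "\<alpha> > 0"
  then obtain \<beta> \<gamma> :: 'a where "\<beta> > 0" "\<gamma> > 0" and sum_less: "\<beta> + \<gamma> < \<alpha>"
    using assms(1) unfolding dense_ring_def by blast
  obtain a where lim: "ring_converges_to s a"
    using assms(2) unfolding ring_convergent_def by blast
  obtain M where M: "\<And>n. n \<ge> M \<Longrightarrow> \<bar>s n - a\<bar> < \<beta>"
    using lim \<open>\<beta> > 0\<close> unfolding ring_converges_to_def by blast
  obtain N where N: "\<And>n. n \<ge> N \<Longrightarrow> \<bar>s n - a\<bar> < \<gamma>"
    using lim \<open>\<gamma> > 0\<close> unfolding ring_converges_to_def by blast
  have "\<bar>s n - s m\<bar> < \<alpha>" if "m \<ge> max M N" "n \<ge> max M N" for m n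
  proof -
    have "\<bar>s n - s m\<bar> = \<bar>(s n - a) - (s m - a)\<bar>"
      by simp
    also have "\<dots> \<le> \<bar>s n - a\<bar> + \<bar>s m - a\<bar>"
      by (rule abs_triangle_ineq4)
    also have "\<dots> < \<beta> + \<gamma>"
      using M N that by (intro add_strict_mono) auto
    finally show ?thesis
      using sum_less by (rule less_trans)
  qed
  then show "\<exists>N. \<forall>m\<ge>N. \<forall>n\<ge>N. \<bar>s n - s m\<bar> < \<alpha>"
    by blast
qed

text \<open>
  By symmetry of the distance it suffices to compare indices in increasing order, so that
  differences of partial sums are genuine blocks of terms.
\<close>

lemma ring_Cauchy_if_ordered:
  fixes s :: "nat \<Rightarrow> 'a :: linordered_ring_strict"
  assumes "\<And>\<epsilon>. \<epsilon> > 0 \<Longrightarrow> \<exists>N. \<forall>m\<ge>N. \<forall>n\<ge>m. \<bar>s n - s m\<bar> < \<epsilon>"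
  shows "ring_Cauchy s"
  unfolding ring_Cauchy_def
proof (intro allI impI)
  fix \<epsilon> :: 'a
  assume "\<epsilon> > 0"
  then obtain N where N: "\<And>m n. m \<ge> N \<Longrightarrow> n \<ge> m \<Longrightarrow> \<bar>s n - s m\<bar> < \<epsilon>"
    using assms by blast
  have "\<bar>s n - s m\<bar> < \<epsilon>" if "m \<ge> N" "n \<ge> N" for m n
    using N[of m n] N[of n m] that by (cases "m \<le> n") (auto simp: abs_minus_commute)
  then show "\<exists>N. \<forall>m\<ge>N. \<forall>n\<ge>N. \<bar>s n - s m\<bar> < \<epsilon>"
    by blast
qed

lemma abs_less_iff_bounds:
  fixes a \<epsilon> :: "'a :: linordered_ring_strict"
  shows "\<bar>a\<bar> < \<epsilon> \<longleftrightarrow> - \<epsilon> < a \<and> a < \<epsilon>"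
  unfolding abs_eq_max_uminus by (auto simp: minus_less_iff[of a])

lemma partial_sum_diff:
  fixes f :: "nat \<Rightarrow> 'a :: ab_group_add"
  assumes "m \<le> n"
  shows "(\<Sum>k=1..n. f k) - (\<Sum>k=1..m. f k) = (\<Sum>k\<in>{m<..n}. f k)"
proof -
  have "{1..n} - {1..m} = {m<..n}"
    using assms by auto
  then show ?thesis
    using assms sum_diff[of "{1..n}" "{1..m}" f] by simp
qed

theorem theorem3p5:
  fixes x y z :: "nat \<Rightarrow> 'a :: linordered_ring_strict"
    and N\<^sub>1 :: nat
  assumes "dense_ring TYPE('a)"
    and "Cauchy_complete_ring TYPE('a)"
    and "\<And>n. n \<ge> N\<^sub>1 \<Longrightarrow> x n \<le> y n \<and> y n \<le> z n"
    and "ring_series_convergent x"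
    and "ring_series_convergent z"
  shows "ring_series_convergent y"
proof -
  have Cauchy_x: "ring_Cauchy (\<lambda>n. \<Sum>k=1..n. x k)"
    and Cauchy_z: "ring_Cauchy (\<lambda>n. \<Sum>k=1..n. z k)"
    using assms(1,4,5) convergent_imp_Cauchy_if_dense
    unfolding ring_series_convergent_def by blast+
  have "ring_Cauchy (\<lambda>n. \<Sum>k=1..n. y k)"
  proof (rule ring_Cauchy_if_ordered)
    fix \<epsilon> :: 'a
    assume "\<epsilon> > 0"
    obtain P where P: "\<And>m n. m \<ge> P \<Longrightarrow> n \<ge> P \<Longrightarrow> \<bar>(\<Sum>k=1..n. x k) - (\<Sum>k=1..m. x k)\<bar> < \<epsilon>"
      using Cauchy_x \<open>\<epsilon> > 0\<close> unfolding ring_Cauchy_def by blast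
    obtain Q where Q: "\<And>m n. m \<ge> Q \<Longrightarrow> n \<ge> Q \<Longrightarrow> \<bar>(\<Sum>k=1..n. z k) - (\<Sum>k=1..m. z k)\<bar> < \<epsilon>"
      using Cauchy_z \<open>\<epsilon> > 0\<close> unfolding ring_Cauchy_def by blast
    have "\<bar>(\<Sum>k=1..n. y k) - (\<Sum>k=1..m. y k)\<bar> < \<epsilon>"
      if m: "m \<ge> max N\<^sub>1 (max P Q)" and n: "n \<ge> m" for m n
    proof -
      have "\<bar>\<Sum>k\<in>{m<..n}. x k\<bar> < \<epsilon>" "\<bar>\<Sum>k\<in>{m<..n}. z k\<bar> < \<epsilon>"
        using P[of m n] Q[of m n] m n partial_sum_diff[OF n, of x] partial_sum_diff[OF n, of z]
        by simp_all
      then have lower: "- \<epsilon> < (\<Sum>k\<in>{m<..n}. x k)" and upper: "(\<Sum>k\<in>{m<..n}. z k) < \<epsilon>"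
        by (simp_all add: abs_less_iff_bounds)
      have "(\<Sum>k\<in>{m<..n}. x k) \<le> (\<Sum>k\<in>{m<..n}. y k)"
        "(\<Sum>k\<in>{m<..n}. y k) \<le> (\<Sum>k\<in>{m<..n}. z k)"
        using assms(3) m by (auto intro!: sum_mono)
      with lower upper have "- \<epsilon> < (\<Sum>k\<in>{m<..n}. y k)" "(\<Sum>k\<in>{m<..n}. y k) < \<epsilon>"
        by (auto intro: less_le_trans le_less_trans)
      then show ?thesis
        unfolding partial_sum_diff[OF n] by (simp add: abs_less_iff_bounds)
    qed
    then show "\<exists>N. \<forall>m\<ge>N. \<forall>n\<ge>m. \<bar>(\<Sum>k=1..n. y k) - (\<Sum>k=1..m. y k)\<bar> < \<epsilon>"
      by blast
  qed
  then show ?thesis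
    using assms(2) unfolding Cauchy_complete_ring_def ring_series_convergent_def by blast
qed

end
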